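(* Let $\mathcal{D}=(\mathcal{P},\mathcal{B})$ be a $G$-block-transitive $t$-$(v,k,1)$ design with $t\geq 3$, and let $H$ be a subgroup of $G$. (a) If $H$ has order $t$ and is semiregular on $\mathcal{P}$, then $v$ is divisible by $k$. (b) If $H$ has order $t$ and is quasi-semiregular on $\mathcal{P}$, then $v-1$ is divisible by $k$ or $k-1$. (c) If $H$ has order $t-1$ and is quasi-semiregular on $\mathcal{P}$, then $v-1$ is divisible by $k-1$.
   Context: For an integer $t\ge 2$, a $t$-$(v,k,1)$ design $\mathcal{D}=(\mathcal{P},\mathcal{B})$ consists of a finite set $\mathcal{P}$ of $v$ points and a collection $\mathcal{B}$ of $k$-subsets of $\mathcal{P}$, called blocks, such that each $t$-subset of $\mathcal{P}$ lies in a unique block. An automorphism of $\mathcal{D}$ is a permutation of $\mathcal{P}$ which permutes the blocks among themselves; these form the group $\mathrm{Aut}(\mathcal{D})$. For a subgroup $G\leq \mathrm{Aut}(\mathcal{D})$, the design is $G$-block-transitive if $G$ acts transitively on $\mathcal{B}$. A permutation group is semiregular if the stabilizer of every point is trivial. A permutation group on a finite set is quasi-semiregular if it fixes only one point and acts semiregularly on the set of remaining points. *)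

theory Defs
  imports "HOL-Algebra.Group_Action"
begin

section \<open>Designs and their automorphisms\<close>

locale t_design =
  fixes t v k :: nat and P :: "'a set" and B :: "'a set set"
  assumes t_ge_2: "t \<ge> 2"
    and finite_points: "finite P"
    and card_points: "card P = v"
    and block_subset: "b \<in> B \<Longrightarrow> b \<subseteq> P"
    and card_block: "b \<in> B \<Longrightarrow> card b = k"
    and unique_block: "\<lbrakk>T \<subseteq> P; card T = t\<rbrakk> \<Longrightarrow> \<exists>!b. b \<in> B \<and> T \<subseteq> b"

definition design_auts :: "'a set \<Rightarrow> 'a set set \<Rightarrow> ('a \<Rightarrow> 'a) set"
  where "design_auts P B = {g \<in> Bij P. bij_betw (\<lambda>b. g ` b) B B}"

definition Aut :: "'a set \<Rightarrow> 'a set set \<Rightarrow> ('a \<Rightarrow> 'a) monoid"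
  where "Aut P B = BijGroup P \<lparr>carrier := design_auts P B\<rparr>"

text \<open>The maps below are restricted to \<^term>\<open>B\<close> because the elements of
  \<^const>\<open>BijGroup\<close> are extensional functions.\<close>

definition block_map :: "'a set set \<Rightarrow> ('a \<Rightarrow> 'a) \<Rightarrow> 'a set \<Rightarrow> 'a set"
  where "block_map B g = (\<lambda>b \<in> B. g ` b)"

definition block_transitive :: "'a set \<Rightarrow> 'a set set \<Rightarrow> ('a \<Rightarrow> 'a) set \<Rightarrow> bool"
  where "block_transitive P B G \<longleftrightarrow>
    transitive_action (Aut P B \<lparr>carrier := G\<rparr>) B (block_map B)"

section \<open>Semiregular and quasi-semiregular actions\<close>

locale semiregular_action = group_action +
  assumes trivial_stabilizer: "x \<in> E \<Longrightarrow> stabilizer G \<phi> x = {\<one>}"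

locale quasi_semiregular_action = group_action +
  assumes quasi_semiregular:
    "\<exists>a. {x \<in> E. \<forall>g \<in> carrier G. \<phi> g x = x} = {a} \<and>
         semiregular_action G (E - {a}) (\<lambda>g. restrict (\<phi> g) (E - {a}))"

section \<open>The actions above are well defined\<close>

lemma subgroup_design_auts:
  assumes "\<And>b. b \<in> B \<Longrightarrow> b \<subseteq> P"
  shows "subgroup (design_auts P B) (BijGroup P)"
proof -
  have comp: "compose P g h ` b = g ` (h ` b)" if "b \<in> B" for g h :: "'a \<Rightarrow> 'a" and b
    using assms[OF that] by (force simp: compose_def image_iff)
  interpret group "BijGroup P" by (rule group_BijGroup)
  show ?thesis
  proof (rule subgroup.intro)
    show "design_auts P B \<subseteq> carrier (BijGroup P)"
      by (auto simp: design_auts_def BijGroup_def)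
  next
    fix g h assume gh: "g \<in> design_auts P B" "h \<in> design_auts P B"
    have "bij_betw ((\<lambda>b. g ` b) \<circ> (\<lambda>b. h ` b)) B B"
      using gh unfolding design_auts_def by (blast intro: bij_betw_trans)
    then have "bij_betw (\<lambda>b. compose P g h ` b) B B"
      by (rule iffD1[OF bij_betw_cong, rotated]) (simp add: comp)
    with gh show "g \<otimes>\<^bsub>BijGroup P\<^esub> h \<in> design_auts P B"
      by (auto simp: design_auts_def BijGroup_def compose_Bij)
  next
    have img: "(\<lambda>x\<in>P. x) ` b = b" if "b \<in> B" for b
      using assms[OF that] by (force simp: image_iff)
    have "bij_betw (\<lambda>b. (\<lambda>x\<in>P. x) ` b) B B \<longleftrightarrow> bij_betw id B B"
      by (rule bij_betw_cong) (simp only: img id_apply)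
    then have "(\<lambda>x\<in>P. x) \<in> design_auts P B"
      unfolding design_auts_def using id_Bij by blast
    then show "\<one>\<^bsub>BijGroup P\<^esub> \<in> design_auts P B"
      by (simp only: BijGroup_def monoid.simps)
  next
    fix g assume g: "g \<in> design_auts P B"
    let ?h = "\<lambda>x\<in>P. inv_into P g x"
    have gP: "bij_betw g P P" and gB: "bij_betw (\<lambda>b. g ` b) B B"
      using g by (auto simp: design_auts_def Bij_def)
    have left: "?h ` (g ` b) = b" if "b \<in> B" for b
    proof -
      have "?h (g x) = x" if "x \<in> b" for x
        using that assms[OF \<open>b \<in> B\<close>] gP
        by (auto simp: bij_betw_def inv_into_f_f)
      then have "(\<lambda>x. ?h (g x)) ` b = (\<lambda>x. x) ` b" by (intro image_cong refl)
      then show ?thesis by (simp only: image_image image_ident)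
    qed
    have "bij_betw (\<lambda>b. ?h ` b) B B"
    proof (rule bij_betw_byWitness[where f' = "\<lambda>b. g ` b"])
      have img: "(\<lambda>b. g ` b) ` B = B" using gB by (simp add: bij_betw_def)
      show "\<forall>b\<in>B. g ` (?h ` b) = b"
      proof
        fix b assume "b \<in> B"
        then obtain c where "c \<in> B" "b = g ` c" using img by blast
        then show "g ` (?h ` b) = b" using left[of c] by (simp only:)
      qed
      show "\<forall>b\<in>B. ?h ` (g ` b) = b" using left by blast
      show "(\<lambda>b. g ` b) ` B \<subseteq> B" using img by simp
      show "(\<lambda>b. ?h ` b) ` B \<subseteq> B"
      proof (rule image_subsetI)
        fix b assume "b \<in> B"
        then obtain c where "c \<in> B" "b = g ` c" using img by blast
        then show "?h ` b \<in> B" using left[of c] by (simp only:)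
      qed
    qed
    moreover have "g \<in> Bij P" using g by (simp add: design_auts_def)
    ultimately have "?h \<in> design_auts P B"
      unfolding design_auts_def using restrict_inv_into_Bij by blast
    then show "inv\<^bsub>BijGroup P\<^esub> g \<in> design_auts P B"
      using inv_BijGroup[OF \<open>g \<in> Bij P\<close>] by (simp only:)
  qed
qed

lemma group_Aut:
  assumes "\<And>b. b \<in> B \<Longrightarrow> b \<subseteq> P"
  shows "group (Aut P B)"
  unfolding Aut_def
  by (rule subgroup.subgroup_is_group[OF subgroup_design_auts[OF assms] group_BijGroup])

lemma group_action_points:
  assumes B: "\<And>b. b \<in> B \<Longrightarrow> b \<subseteq> P" and G: "subgroup G (Aut P B)"
  shows "group_action (Aut P B \<lparr>carrier := G\<rparr>) P (\<lambda>g. g)"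
proof -
  have "group (Aut P B \<lparr>carrier := G\<rparr>)"
    by (rule subgroup.subgroup_is_group[OF G group_Aut[OF B]])
  moreover have "G \<subseteq> design_auts P B"
    using subgroup.subset[OF G] by (simp add: Aut_def)
  ultimately show ?thesis
    by (intro group_action.intro group_hom.intro group_hom_axioms.intro group_BijGroup)
      (auto simp: hom_def Aut_def BijGroup_def design_auts_def)
qed

lemma group_action_blocks:
  assumes B: "\<And>b. b \<in> B \<Longrightarrow> b \<subseteq> P" and G: "subgroup G (Aut P B)"
  shows "group_action (Aut P B \<lparr>carrier := G\<rparr>) B (block_map B)"
proof -
  have comp: "compose P g h ` b = g ` (h ` b)" if "b \<in> B" for g h :: "'a \<Rightarrow> 'a" and b
    using B[OF that] by (force simp: compose_def image_iff)
  have "group (Aut P B \<lparr>carrier := G\<rparr>)"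
    by (rule subgroup.subgroup_is_group[OF G group_Aut[OF B]])
  moreover have GA: "G \<subseteq> design_auts P B"
    using subgroup.subset[OF G] by (simp add: Aut_def)
  moreover have bij: "block_map B g \<in> Bij B" if "g \<in> G" for g
  proof -
    have "bij_betw (\<lambda>b. g ` b) B B" using GA that by (auto simp: design_auts_def)
    then show ?thesis
      by (simp add: block_map_def Bij_def cong: bij_betw_cong)
  qed
  moreover have "block_map B (compose P g h) = compose B (block_map B g) (block_map B h)"
    if "g \<in> G" "h \<in> G" for g h
  proof
    fix b
    have "h ` b \<in> B" if "b \<in> B"
      using GA \<open>h \<in> G\<close> that by (auto simp: design_auts_def bij_betw_def)
    then show "block_map B (compose P g h) b = compose B (block_map B g) (block_map B h) b"
      by (cases "b \<in> B") (simp_all add: block_map_def compose_def[of B] comp)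
  qed
  moreover have "G \<subseteq> Bij P" using GA by (auto simp: design_auts_def)
  ultimately show ?thesis
    by (intro group_action.intro group_hom.intro group_hom_axioms.intro group_BijGroup)
      (auto simp: hom_def Aut_def BijGroup_def subset_iff)
qed

end

theory Submission
  imports Defs
begin

text \<open>
  The idea is to partition the points moved by \<^term>\<open>H\<close> by means of the blocks that every
  element of \<^term>\<open>H\<close> maps to itself. Suppose that a regular \<^term>\<open>H\<close>-orbit, enlarged by at
  most one point fixed by \<^term>\<open>H\<close>, has exactly \<^term>\<open>t\<close> points. The block through these
  points contains their image under each \<^term>\<open>h \<in> H\<close>, which is the same set, so uniqueness
  makes the block invariant. Conversely, an invariant block through a point contains the whole
  orbit of that point, so two invariant blocks (through the chosen fixed point, if there is one)
  that share a moved point share \<^term>\<open>t\<close> points and coincide. Hence these blocks partition the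
  moved points (lemma \<open>unique_invariant_block\<close>), and a common divisor of the sizes of the parts
  divides the number of moved points.

  In the semiregular case the parts are whole blocks, of size \<^term>\<open>k\<close>. In the quasi-semiregular
  case let \<^term>\<open>a\<close> be the fixed point. If \<^term>\<open>H\<close> has order \<^term>\<open>t - 1\<close>, each orbit is
  enlarged by \<^term>\<open>a\<close>, so all parts are blocks minus \<^term>\<open>a\<close>, of size \<^term>\<open>k - 1\<close>. If
  \<^term>\<open>H\<close> has order \<^term>\<open>t\<close>, a part has size \<^term>\<open>k\<close> or \<^term>\<open>k - 1\<close>, according to
  whether its block avoids or contains \<^term>\<open>a\<close>; being a union of regular orbits, it has size
  divisible by \<^term>\<open>t\<close>. As \<^term>\<open>t \<ge> 2\<close> cannot divide both \<^term>\<open>k\<close> and \<^term>\<open>k - 1\<close>, all parts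
  have the same size.
\<close>

lemma dvd_card_if_unique_cover:
  assumes "finite R"
    and cover: "\<And>x. x \<in> R \<Longrightarrow> \<exists>!b. b \<in> F \<and> x \<in> b"
    and part: "\<And>b x. \<lbrakk>b \<in> F; x \<in> b; x \<in> R\<rbrakk> \<Longrightarrow> m dvd card (b \<inter> R)"
  shows "m dvd card R"
proof -
  \<comment> \<open>Members of \<^term>\<open>F\<close> may meet outside \<^term>\<open>R\<close>, where they are not constrained, so only their
    traces on \<^term>\<open>R\<close> are disjoint.\<close>
  let ?C = "(\<lambda>b. b \<inter> R) ` F - {{}}"
  have "\<exists>b\<in>F. x \<in> b" if "x \<in> R" for x using cover[OF that] by blast
  then have R: "\<Union>?C = R" by blast
  have "m dvd card (\<Union>?C)"
  proof (rule dvd_partition)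
    show "finite (\<Union>?C)" using R \<open>finite R\<close> by simp
    show "\<forall>c\<in>?C. m dvd card c" using part by blast
    show "\<forall>c1\<in>?C. \<forall>c2\<in>?C. c1 \<noteq> c2 \<longrightarrow> c1 \<inter> c2 = {}"
    proof (intro ballI impI, rule ccontr)
      fix c1 c2 assume c: "c1 \<in> ?C" "c2 \<in> ?C" "c1 \<noteq> c2" "c1 \<inter> c2 \<noteq> {}"
      then obtain b1 b2 x where "b1 \<in> F" "c1 = b1 \<inter> R" "b2 \<in> F" "c2 = b2 \<inter> R"
        "x \<in> b1" "x \<in> b2" "x \<in> R" by blast
      then show False using cover[of x] \<open>c1 \<noteq> c2\<close> by blast
    qed
  qed
  then show ?thesis using R by simp
qed

lemma (in semiregular_action) card_orbit:
  assumes "x \<in> E"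
  shows "card (orbit G \<phi> x) = order G"
  using orbit_stabilizer_theorem[OF assms] trivial_stabilizer[OF assms] by simp

lemma (in semiregular_action) order_dvd_card_invariant:
  assumes "finite X" "X \<subseteq> E"
    and inv: "\<And>g x. \<lbrakk>g \<in> carrier G; x \<in> X\<rbrakk> \<Longrightarrow> \<phi> g x \<in> X"
  shows "order G dvd card X"
proof (rule dvd_card_if_unique_cover[OF \<open>finite X\<close>, where F = "orbits G E \<phi>"])
  fix x assume "x \<in> X"
  then show "\<exists>!b. b \<in> orbits G E \<phi> \<and> x \<in> b"
    using orbits_coverture disjoint_union \<open>X \<subseteq> E\<close> by blast
next
  fix b x assume b: "b \<in> orbits G E \<phi>" "x \<in> b" "x \<in> X"
  then have xE: "x \<in> E" using \<open>X \<subseteq> E\<close> by blast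
  then have "orbit G \<phi> x \<in> orbits G E \<phi>" by (auto simp: orbits_def)
  then have "b = orbit G \<phi> x" using disjoint_union[OF b(1)] orbit_refl[OF xE] b(2) by blast
  moreover have "orbit G \<phi> x \<subseteq> X" using inv b(3) by (auto simp: orbit_def)
  ultimately show "order G dvd card (b \<inter> X)" using card_orbit[OF xE] by (simp add: Int_absorb2)
qed

text \<open>The orbit of \<^term>\<open>x\<close> together with \<^term>\<open>C\<close> is a \<^term>\<open>t\<close>-set that \<^term>\<open>H\<close> preserves, so
  \<^term>\<open>H\<close> preserves the one block through it; any invariant block containing \<^term>\<open>x\<close> and
  \<^term>\<open>C\<close> contains this \<^term>\<open>t\<close>-set. An empty \<^term>\<open>C\<close> serves for groups of order
  \<^term>\<open>t\<close>, a single fixed point for groups of order \<^term>\<open>t - 1\<close>.\<close>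

lemma (in t_design) unique_invariant_block:
  assumes H: "subgroup H (Aut P B)"
    and x: "x \<in> P" and C: "C \<subseteq> P" "\<And>h c. \<lbrakk>h \<in> H; c \<in> C\<rbrakk> \<Longrightarrow> h c = c"
    and card: "card (orbit (Aut P B \<lparr>carrier := H\<rparr>) (\<lambda>h. h) x \<union> C) = t"
  shows "\<exists>!b. b \<in> {b \<in> B. C \<subseteq> b \<and> (\<forall>h\<in>H. h ` b = b)} \<and> x \<in> b"
proof -
  let ?A = "Aut P B \<lparr>carrier := H\<rparr>"
  let ?O = "orbit ?A (\<lambda>h. h) x"
  interpret group_action ?A P "\<lambda>h. h" by (rule group_action_points[OF block_subset H])
  have H_auts: "h \<in> design_auts P B" if "h \<in> H" for h
    using subgroup.subset[OF H] that by (auto simp: Aut_def)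
  have O_def: "?O = (\<lambda>h. h x) ` H" by (auto simp: orbit_def)
  have T_sub: "?O \<union> C \<subseteq> P" using element_image x C(1) by (auto simp: O_def)
  have T_inv: "h ` (?O \<union> C) = ?O \<union> C" if h: "h \<in> H" for h
  proof (rule endo_inj_surj)
    show "finite (?O \<union> C)" using T_sub finite_points by (rule finite_subset)
    show "inj_on h (?O \<union> C)" using inj_prop[of h] h T_sub by (auto intro: inj_on_subset)
    have "h y \<in> ?O" if "y \<in> ?O" for y
    proof (rule orbit_trans[OF x _ _ that])
      show "y \<in> P" using that T_sub by blast
      then show "h y \<in> P" using element_image[of h y "h y"] h by simp
      show "h y \<in> orbit ?A (\<lambda>h. h) y" using h by (auto simp: orbit_def)
    qed
    then show "h ` (?O \<union> C) \<subseteq> ?O \<union> C" using C(2)[OF h] by auto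
  qed
  note block = unique_block[OF T_sub card]
  then obtain b where b: "b \<in> B" "?O \<union> C \<subseteq> b" by blast
  have inv: "h ` b = b" if h: "h \<in> H" for h
  proof -
    have "h ` b \<in> B" using H_auts[OF h] b(1) by (auto simp: design_auts_def bij_betw_def)
    moreover have "?O \<union> C \<subseteq> h ` b" using T_inv[OF h] b(2) by blast
    ultimately show ?thesis using block b by blast
  qed
  have xb: "x \<in> b" using orbit_refl[OF x] b(2) by blast
  have unique: "b' = b"
    if b': "b' \<in> B" "C \<subseteq> b'" "\<forall>h\<in>H. h ` b' = b'" "x \<in> b'" for b'
  proof -
    have "?O \<union> C \<subseteq> b'" using b' by (auto simp: O_def)
    then show ?thesis using block b b'(1) by blast
  qed
  show ?thesis
  proof (rule ex1I[of _ b])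
    show "b \<in> {b \<in> B. C \<subseteq> b \<and> (\<forall>h\<in>H. h ` b = b)} \<and> x \<in> b"
      using b inv xb by blast
  qed (use unique in blast)
qed

lemma (in t_design) semiregular_k_dvd:
  assumes H: "subgroup H (Aut P B)"
    and ord: "order (Aut P B \<lparr>carrier := H\<rparr>) = t"
    and semi: "semiregular_action (Aut P B \<lparr>carrier := H\<rparr>) P (\<lambda>h. h)"
  shows "k dvd v"
proof -
  interpret semiregular_action "Aut P B \<lparr>carrier := H\<rparr>" P "\<lambda>h. h" by (rule semi)
  have "k dvd card P"
  proof (rule dvd_card_if_unique_cover[OF finite_points])
    fix x assume "x \<in> P"
    then show "\<exists>!b. b \<in> {b \<in> B. {} \<subseteq> b \<and> (\<forall>h\<in>H. h ` b = b)} \<and> x \<in> b"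
      using card_orbit ord by (intro unique_invariant_block[OF H]) auto
  qed (auto simp: Int_absorb2 block_subset card_block)
  then show ?thesis by (simp add: card_points)
qed

text \<open>The definition of quasi-semiregularity speaks of the action restricted to the moved points,
  whereas \<open>unique_invariant_block\<close> speaks of orbits of the action on all of \<^term>\<open>P\<close>. The
  translation works because moved points stay moved, so their orbits are the same in both actions.
  The last fact holds because the moved part of an invariant set is a union of regular orbits.\<close>

lemma (in t_design) quasi_semiregular_fixed_point:
  assumes "quasi_semiregular_action (Aut P B \<lparr>carrier := H\<rparr>) P (\<lambda>h. h)"
  obtains a where "a \<in> P" "\<And>h. h \<in> H \<Longrightarrow> h a = a"
    "\<And>x. x \<in> P - {a} \<Longrightarrow>
      card (orbit (Aut P B \<lparr>carrier := H\<rparr>) (\<lambda>h. h) x) = order (Aut P B \<lparr>carrier := H\<rparr>)"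
    "\<And>x. x \<in> P - {a} \<Longrightarrow> a \<notin> orbit (Aut P B \<lparr>carrier := H\<rparr>) (\<lambda>h. h) x"
    "\<And>b. \<forall>h\<in>H. h ` b = b \<Longrightarrow> order (Aut P B \<lparr>carrier := H\<rparr>) dvd card (b \<inter> (P - {a}))"
proof -
  let ?A = "Aut P B \<lparr>carrier := H\<rparr>"
  interpret quasi_semiregular_action ?A P "\<lambda>h. h" by (rule assms)
  obtain a where fix_a: "{x \<in> P. \<forall>h\<in>carrier ?A. h x = x} = {a}"
    and semi: "semiregular_action ?A (P - {a}) (\<lambda>h. restrict h (P - {a}))"
    using quasi_semiregular by blast
  interpret moved: semiregular_action ?A "P - {a}" "\<lambda>h. restrict h (P - {a})" by (rule semi)
  have aP: "a \<in> P" using fix_a by blast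
  have orb: "orbit ?A (\<lambda>h. restrict h (P - {a})) x = orbit ?A (\<lambda>h. h) x" if "x \<in> P - {a}" for x
    using that by (simp add: orbit_def)
  have moved_image: "h x \<in> P - {a}" if "h \<in> H" "x \<in> P - {a}" for h x
    using moved.element_image[of h x "h x"] that by simp
  show thesis
  proof (rule that[OF aP])
    show "h a = a" if "h \<in> H" for h using fix_a that by auto
    fix x assume x: "x \<in> P - {a}"
    show "card (orbit ?A (\<lambda>h. h) x) = order ?A" using moved.card_orbit[OF x] orb[OF x] by simp
    show "a \<notin> orbit ?A (\<lambda>h. h) x" using moved_image[OF _ x] by (auto simp: orbit_def)
  next
    fix b assume b: "\<forall>h\<in>H. h ` b = b"
    show "order ?A dvd card (b \<inter> (P - {a}))"
    proof (rule moved.order_dvd_card_invariant)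
      fix h x assume "h \<in> carrier ?A" "x \<in> b \<inter> (P - {a})"
      then show "restrict h (P - {a}) x \<in> b \<inter> (P - {a})" using moved_image[of h x] b by auto
    qed (use finite_points in auto)
  qed
qed

lemma (in t_design) quasi_semiregular_k_or_k_minus_1_dvd:
  assumes H: "subgroup H (Aut P B)"
    and ord: "order (Aut P B \<lparr>carrier := H\<rparr>) = t"
    and quasi: "quasi_semiregular_action (Aut P B \<lparr>carrier := H\<rparr>) P (\<lambda>h. h)"
  shows "k dvd (v - 1) \<or> (k - 1) dvd (v - 1)"
proof -
  let ?F = "{b \<in> B. {} \<subseteq> b \<and> (\<forall>h\<in>H. h ` b = b)}"
  obtain a where a: "a \<in> P"
    and orb: "\<And>x. x \<in> P - {a} \<Longrightarrow> card (orbit (Aut P B \<lparr>carrier := H\<rparr>) (\<lambda>h. h) x) = t"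
    and t_dvd: "\<And>b. \<forall>h\<in>H. h ` b = b \<Longrightarrow> t dvd card (b \<inter> (P - {a}))"
    by (rule quasi_semiregular_fixed_point[OF quasi, unfolded ord], rule that; blast)
  have card_part: "card (b \<inter> (P - {a})) = (if a \<in> b then k - 1 else k)" if "b \<in> B" for b
  proof -
    have "b \<inter> (P - {a}) = b - {a}" using block_subset[OF that] by blast
    then show ?thesis using card_block[OF that] by (auto simp: card_Diff_singleton_if)
  qed
  \<comment> \<open>The only possible size of a part, since \<^term>\<open>t\<close> divides that size and cannot divide both
    candidates.\<close>
  define m where "m = (if t dvd k then k else k - 1)"
  have "m dvd card (P - {a})"
  proof (rule dvd_card_if_unique_cover)
    show "finite (P - {a})" using finite_points by simp
    fix x assume "x \<in> P - {a}"
    then show "\<exists>!b. b \<in> ?F \<and> x \<in> b"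
      using orb by (intro unique_invariant_block[OF H]) auto
  next
    fix b x assume b: "b \<in> ?F" "x \<in> b" "x \<in> P - {a}"
    \<comment> \<open>Positivity of \<^term>\<open>k\<close> matters: with truncated subtraction \<^term>\<open>t\<close> would divide both
      \<^term>\<open>k\<close> and \<^term>\<open>k - 1\<close> if \<^term>\<open>k\<close> were zero.\<close>
    have "finite b" using b block_subset finite_points by (blast intro: finite_subset)
    then have "k > 0" using b card_block[of b] by (auto simp: card_gt_0_iff)
    then have not_both: "\<not> (t dvd k \<and> t dvd k - 1)"
      using t_ge_2 dvd_diff_nat[of t k "k - 1"] by auto
    have "t dvd card (b \<inter> (P - {a}))" using b t_dvd by blast
    then have "card (b \<inter> (P - {a})) = m"
      using card_part[of b] b not_both by (auto simp: m_def split: if_splits)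
    then show "m dvd card (b \<inter> (P - {a}))" by simp
  qed
  moreover have "card (P - {a}) = v - 1" using a by (simp add: card_Diff_singleton card_points)
  ultimately show ?thesis by (auto simp: m_def split: if_splits)
qed

lemma (in t_design) quasi_semiregular_k_minus_1_dvd:
  assumes H: "subgroup H (Aut P B)"
    and ord: "order (Aut P B \<lparr>carrier := H\<rparr>) = t - 1"
    and quasi: "quasi_semiregular_action (Aut P B \<lparr>carrier := H\<rparr>) P (\<lambda>h. h)"
  shows "(k - 1) dvd (v - 1)"
proof -
  let ?orb = "orbit (Aut P B \<lparr>carrier := H\<rparr>) (\<lambda>h. h)"
  obtain a where a: "a \<in> P" "\<And>h. h \<in> H \<Longrightarrow> h a = a"
    and orb: "\<And>x. x \<in> P - {a} \<Longrightarrow> card (?orb x) = t - 1"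
    and notin: "\<And>x. x \<in> P - {a} \<Longrightarrow> a \<notin> ?orb x"
    by (rule quasi_semiregular_fixed_point[OF quasi, unfolded ord], rule that; blast)
  have "k - 1 dvd card (P - {a})"
  proof (rule dvd_card_if_unique_cover)
    show "finite (P - {a})" using finite_points by simp
    fix x assume x: "x \<in> P - {a}"
    have "card (?orb x) > 0" using orb[OF x] t_ge_2 by simp
    then have "finite (?orb x)" by (rule card_ge_0_finite)
    then have "card (?orb x \<union> {a}) = t" using orb[OF x] notin[OF x] t_ge_2 by simp
    then show "\<exists>!b. b \<in> {b \<in> B. {a} \<subseteq> b \<and> (\<forall>h\<in>H. h ` b = b)} \<and> x \<in> b"
      using x a by (intro unique_invariant_block[OF H]) auto
  next
    fix b x assume b: "b \<in> {b \<in> B. {a} \<subseteq> b \<and> (\<forall>h\<in>H. h ` b = b)}"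
    then have "b \<inter> (P - {a}) = b - {a}" using block_subset by blast
    then show "k - 1 dvd card (b \<inter> (P - {a}))"
      using b card_block by (auto simp: card_Diff_singleton_if)
  qed
  then show ?thesis using a by (simp add: card_Diff_singleton card_points)
qed

theorem lemma2p7:
  fixes t v k :: nat and P :: "'a set" and B :: "'a set set"
    and G H :: "('a \<Rightarrow> 'a) set"
  assumes "t_design t v k P B"
    and "t \<ge> 3"
    and "subgroup G (Aut P B)"
    and "block_transitive P B G"
    and "subgroup H (Aut P B \<lparr>carrier := G\<rparr>)"
  shows "(order (Aut P B \<lparr>carrier := H\<rparr>) = t \<longrightarrow>
            semiregular_action (Aut P B \<lparr>carrier := H\<rparr>) P (\<lambda>h. h) \<longrightarrow>
            k dvd v) \<and>
         (order (Aut P B \<lparr>carrier := H\<rparr>) = t \<longrightarrow>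
            quasi_semiregular_action (Aut P B \<lparr>carrier := H\<rparr>) P (\<lambda>h. h) \<longrightarrow>
            k dvd (v - 1) \<or> (k - 1) dvd (v - 1)) \<and>
         (order (Aut P B \<lparr>carrier := H\<rparr>) = t - 1 \<longrightarrow>
            quasi_semiregular_action (Aut P B \<lparr>carrier := H\<rparr>) P (\<lambda>h. h) \<longrightarrow>
            (k - 1) dvd (v - 1))"
proof -
  interpret t_design t v k P B by (rule assms(1))
  have H: "subgroup H (Aut P B)"
    by (rule group.incl_subgroup[OF group_Aut[OF block_subset] assms(3,5)])
  show ?thesis
    by (intro conjI impI semiregular_k_dvd[OF H] quasi_semiregular_k_or_k_minus_1_dvd[OF H]
        quasi_semiregular_k_minus_1_dvd[OF H])
qed

end
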